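(* Let $C\subseteq\mathbb{F}_q^n$ be an $\mathbb{F}_q$-linear code of length $n$, let $T\subseteq[n]$, and let $m$ be a positive integer. Then $$J_{C,T}(w,z,x,y;q^m)=\sum_{s=0}^{n-|T|}\sum_{t=0}^{|T|}Q_{s,t}^{q^m}(C;T)\,(w-z)^{t}z^{|T|-t}(x-y)^{s}y^{n-|T|-s}.$$
   Context: $q$ is a prime power, $[n]=\{1,\dots,n\}$, $\overline{T}=[n]\setminus T$, and $\binom{S}{s}$ denotes the set of $s$-subsets of a set $S$. An $\mathbb{F}_q$-linear code of length $n$ is an $\mathbb{F}_q$-linear subspace $C$ of $\mathbb{F}_q^n$. For a positive integer $m$, the extension code $C[q^m]=C\otimes\mathbb{F}_{q^m}\subseteq\mathbb{F}_{q^m}^n$ is the set of all $\mathbb{F}_{q^m}$-linear combinations of codewords of $C$. For a vector $u$ and $S\subseteq[n]$, $\mathrm{wt}_S(u)=\#\{i\in S : u_i\ne0\}$. The $q^m$-extended Jacobi polynomial is $$J_{C,T}(w,z,x,y;q^m)=\sum_{i=0}^{n-|T|}\sum_{j=0}^{|T|}A_{i,j}^{q^m}(C;T)\,w^{|T|-j}z^{j}x^{n-|T|-i}y^{i},$$ where $A_{i,j}^{q^m}(C;T)=\#\{u\in C[q^m] : \mathrm{wt}_{\overline{T}}(u)=i,\ \mathrm{wt}_T(u)=j\}$. For $X\subseteq\overline{T}$ and $Y\subseteq T$ put $C_T(X,Y)=\{u\in C : u_i=0\text{ for all }i\in X\cup Y\}$, $\ell_T(X,Y)=\dim_{\mathbb{F}_q}C_T(X,Y)$,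 $B_{X,Y}^{q^m}(C;T)=(q^m)^{\ell_T(X,Y)}$, and $$Q_{s,t}^{q^m}(C;T)=\sum_{X\in\binom{\overline{T}}{s}}\ \sum_{Y\in\binom{T}{t}}B_{X,Y}^{q^m}(C;T).$$ *)

theory Defs
  imports "HOL-Analysis.Analysis" "HOL-Library.Poly_Mapping"
begin

text \<open>
  The field with \<open>q\<close> elements is a finite field type \<open>'a\<close>, so that \<open>q = CARD('a)\<close>. The index
  set \<open>[n]\<close> is a finite type \<open>'n\<close>, so that \<open>n = CARD('n)\<close>, and the complement of
  \<open>T :: 'n set\<close> is \<open>- T\<close>. Subspaces, spans and dimensions over the scalar field are those of the
  library interpretation \<open>vec\<close> of vector spaces with scalar multiplication \<open>(*s)\<close>.
\<close>

definition field_embedding :: "('a::field \<Rightarrow> 'b::field) \<Rightarrow> bool" where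
  "field_embedding \<phi> \<longleftrightarrow>
     \<phi> 1 = 1 \<and> (\<forall>a b. \<phi> (a + b) = \<phi> a + \<phi> b) \<and> (\<forall>a b. \<phi> (a * b) = \<phi> a * \<phi> b)"

text \<open>
  \<open>ext_code \<phi> C\<close> is the extension code of \<open>C\<close>, where \<open>\<phi>\<close> is the inclusion of the base field in
  the extension field: the set of all linear combinations of codewords, with coefficients in the
  extension field.
\<close>

definition ext_code :: "('a::field \<Rightarrow> 'b::field) \<Rightarrow> ('a ^ 'n) set \<Rightarrow> ('b ^ 'n) set" where
  "ext_code \<phi> C = vec.span ((\<lambda>u. \<chi> i. \<phi> (u $ i)) ` C)"

definition wt :: "'n set \<Rightarrow> 'b::zero ^ 'n \<Rightarrow> nat" where
  "wt S u = card {i \<in> S. u $ i \<noteq> 0}"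

text \<open>
  The polynomial ring over the integers in the four indeterminates \<open>w, z, x, y\<close>: finitely
  supported functions from exponent vectors to coefficients, with convolution as multiplication.
\<close>

datatype indet = Ind_w | Ind_z | Ind_x | Ind_y

type_synonym jpoly = "(indet \<Rightarrow>\<^sub>0 nat) \<Rightarrow>\<^sub>0 int"

definition indet_poly :: "indet \<Rightarrow> jpoly" where
  "indet_poly v = Poly_Mapping.single (Poly_Mapping.single v 1) 1"

abbreviation poly_w :: jpoly where "poly_w \<equiv> indet_poly Ind_w"
abbreviation poly_z :: jpoly where "poly_z \<equiv> indet_poly Ind_z"
abbreviation poly_x :: jpoly where "poly_x \<equiv> indet_poly Ind_x"
abbreviation poly_y :: jpoly where "poly_y \<equiv> indet_poly Ind_y"

definition A_coeff ::
  "('a::field \<Rightarrow> 'b::field) \<Rightarrow> ('a ^ 'n) set \<Rightarrow> 'n set \<Rightarrow> nat \<Rightarrow> nat \<Rightarrow> nat" where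
  "A_coeff \<phi> C T i j = card {u \<in> ext_code \<phi> C. wt (- T) u = i \<and> wt T u = j}"

definition jacobi_poly ::
  "('a::field \<Rightarrow> 'b::field) \<Rightarrow> ('a ^ 'n) set \<Rightarrow> 'n set \<Rightarrow> jpoly" where
  "jacobi_poly \<phi> C T =
     (\<Sum>i = 0..CARD('n) - card T. \<Sum>j = 0..card T.
        of_nat (A_coeff \<phi> C T i j) * poly_w ^ (card T - j) * poly_z ^ j
          * poly_x ^ (CARD('n) - card T - i) * poly_y ^ i)"

text \<open>
  The subscript \<open>T\<close> of \<open>C\<^sub>T(X,Y)\<close> and \<open>\<ell>\<^sub>T(X,Y)\<close> only constrains the ranges of
  \<open>X \<subseteq> - T\<close> and \<open>Y \<subseteq> T\<close>, which are imposed where these are summed over.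
\<close>

definition shortened_code :: "('a::field ^ 'n) set \<Rightarrow> 'n set \<Rightarrow> 'n set \<Rightarrow> ('a ^ 'n) set" where
  "shortened_code C X Y = {u \<in> C. \<forall>i \<in> X \<union> Y. u $ i = 0}"

definition ell :: "('a::field ^ 'n) set \<Rightarrow> 'n set \<Rightarrow> 'n set \<Rightarrow> nat" where
  "ell C X Y = vec.dim (shortened_code C X Y)"

definition B_coeff ::
  "('a::{field,finite} ^ 'n) set \<Rightarrow> nat \<Rightarrow> 'n set \<Rightarrow> 'n set \<Rightarrow> nat" where
  "B_coeff C m X Y = (CARD('a) ^ m) ^ ell C X Y"

definition Q_coeff ::
  "('a::{field,finite} ^ 'n) set \<Rightarrow> 'n set \<Rightarrow> nat \<Rightarrow> nat \<Rightarrow> nat \<Rightarrow> nat" where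
  "Q_coeff C T m s t =
     (\<Sum>X | X \<subseteq> - T \<and> card X = s. \<Sum>Y | Y \<subseteq> T \<and> card Y = t. B_coeff C m X Y)"

end

theory Submission
  imports Defs
begin

text \<open>
  The identity is double counting. Write the Jacobi polynomial as the sum over the words \<open>u\<close> of
  the extension code \<open>D\<close> of the monomial \<open>w\<^sup>a z\<^sup>b x\<^sup>c y\<^sup>d\<close>, where \<open>a\<close> and \<open>b\<close> count the zero and
  nonzero positions of \<open>u\<close> in \<open>T\<close>, and \<open>c\<close> and \<open>d\<close> those outside \<open>T\<close>. Substituting
  \<open>w = (w - z) + z\<close> and \<open>x = (x - y) + y\<close> and expanding turns each monomial into a sum over all
  sets \<open>Y\<close> and \<open>X\<close> of zero positions of \<open>u\<close> inside and outside \<open>T\<close> (\<open>power_wt_expansion\<close>).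
  Interchanging the two summations, the pair \<open>(X, Y)\<close> is weighted by the number of words of \<open>D\<close>
  that vanish on \<open>X \<union> Y\<close>, and grouping the pairs by cardinalities gives the right-hand side,
  provided that this number is \<open>(q\<^sup>m) ^ \<ell>\<^sub>T(X,Y)\<close>.

  This last point is \<open>card_ext_code_vanishing\<close>. Fix a basis of the extension field over the base
  field, which has \<open>m\<close> elements because a span of \<open>k\<close> independent vectors has \<open>q\<^sup>k\<close> elements.
  A word over the extension field lies in \<open>D\<close> if and only if its \<open>m\<close> coordinate words with respect
  to this basis lie in \<open>C\<close>, and it vanishes at a position if and only if all of them do. Hence the
  words of \<open>D\<close> vanishing on a set correspond to \<open>m\<close>-tuples of words of \<open>C\<close> vanishing there.
\<close>

section \<open>Cardinalities of spans over a finite field\<close>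

lemma (in vector_space) card_span_independent:
  assumes "finite B" and "independent B"
  shows "card (span B) = CARD('a) ^ card B"
proof -
  let ?comb = "\<lambda>c. \<Sum>b\<in>B. scale (c b) b"
  have inj: "inj_on ?comb (B \<rightarrow>\<^sub>E UNIV)"
  proof (rule inj_onI)
    fix c d
    assume c: "c \<in> B \<rightarrow>\<^sub>E UNIV" and d: "d \<in> B \<rightarrow>\<^sub>E UNIV" and eq: "?comb c = ?comb d"
    have "(\<Sum>b\<in>B. scale (c b - d b) b) = 0"
      using eq by (simp add: scale_left_diff_distrib sum_subtractf)
    then have "c b - d b = 0" if "b \<in> B" for b
      using independentD[OF assms(2,1) order_refl, of "\<lambda>b. c b - d b"] that by blast
    then show "c = d"
      by (intro PiE_ext[OF c d]) simp
  qed
  have "span B = ?comb ` (B \<rightarrow>\<^sub>E UNIV)"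
  proof
    show "span B \<subseteq> ?comb ` (B \<rightarrow>\<^sub>E UNIV)"
    proof
      fix v assume "v \<in> span B"
      then obtain c where "v = ?comb c"
        using span_finite[OF assms(1)] by auto
      then have "v = ?comb (restrict c B)"
        by simp
      then show "v \<in> ?comb ` (B \<rightarrow>\<^sub>E UNIV)"
        by (intro image_eqI[where x = "restrict c B"]) simp_all
    qed
    show "?comb ` (B \<rightarrow>\<^sub>E UNIV) \<subseteq> span B"
      using span_finite[OF assms(1)] by auto
  qed
  then show ?thesis
    using card_image[OF inj] by (simp add: card_funcsetE assms(1))
qed

lemma card_subspace:
  fixes C :: "('a::{field,finite} ^ 'n::finite) set"
  assumes "vec.subspace C"
  shows "card C = CARD('a) ^ vec.dim C"
proof -
  obtain B where B: "B \<subseteq> C" "vec.independent B" "C \<subseteq> vec.span B" "card B = vec.dim C"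
    by (rule vec.basis_exists)
  have "vec.span B = C"
    using B assms by (metis vec.span_subspace)
  then show ?thesis
    using vec.card_span_independent[of B] B by simp
qed

section \<open>Coordinates of the extension field over the base field\<close>

text \<open>
  Scalars of the base field act on the extension field through the embedding \<open>\<phi>\<close>; this is the
  linearity of a functional from the extension field to the base field.
\<close>

definition base_linear :: "('a::field \<Rightarrow> 'b::field) \<Rightarrow> ('b \<Rightarrow> 'a) \<Rightarrow> bool" where
  "base_linear \<phi> f \<longleftrightarrow>
     (\<forall>b c. f (b + c) = f b + f c) \<and> (\<forall>a b. f (\<phi> a * b) = a * f b)"

lemma base_linear_zero: "base_linear \<phi> f \<Longrightarrow> f 0 = 0"
  unfolding base_linear_def by (metis add_cancel_right_left)

lemma field_embedding_zero: "field_embedding \<phi> \<Longrightarrow> \<phi> 0 = 0"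
  unfolding field_embedding_def by (metis add_cancel_right_left)

lemma field_embedding_coordinates:
  fixes \<phi> :: "'a::{field,finite} \<Rightarrow> 'b::{field,finite}"
  assumes "field_embedding \<phi>" and "CARD('b) = CARD('a) ^ m"
  obtains B :: "'b set" and coord :: "'b \<Rightarrow> 'b \<Rightarrow> 'a"
  where "card B = m"
    and "\<And>e. base_linear \<phi> (coord e)"
    and "\<And>b. (\<Sum>e\<in>B. \<phi> (coord e b) * e) = b"
    and "\<And>c e. e \<in> B \<Longrightarrow> coord e (\<Sum>e\<in>B. \<phi> (c e) * e) = c e"
proof -
  have \<phi>: "\<phi> 1 = 1" "\<phi> (a + b) = \<phi> a + \<phi> b" "\<phi> (a * b) = \<phi> a * \<phi> b" for a b
    using assms(1) unfolding field_embedding_def by auto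
  interpret E: vector_space "\<lambda>a b. \<phi> a * b"
    by unfold_locales (simp_all add: \<phi> algebra_simps)
  obtain B where ind: "E.independent B" and "UNIV \<subseteq> E.span B"
    using E.maximal_independent_subset[of UNIV] by blast
  then have span: "E.span B = UNIV"
    by blast
  have "CARD('a) ^ card B = CARD('a) ^ m"
    using E.card_span_independent[of B] ind span assms(2) by simp
  moreover have "1 < CARD('a)"
  proof -
    have "card {0, 1::'a} \<le> CARD('a)"
      by (rule card_mono) auto
    then show ?thesis
      by simp
  qed
  ultimately have card: "card B = m"
    by (metis power_inject_exp)
  define coord where "coord = (\<lambda>e b. E.representation B b e)"
  have lin: "base_linear \<phi> (coord e)" for e
    unfolding base_linear_def coord_def
    using E.representation_add[OF ind] E.representation_scale[OF ind] span by simp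
  have expand: "(\<Sum>e\<in>B. \<phi> (coord e b) * e) = b" for b
    unfolding coord_def using E.sum_representation_eq[OF ind, of b B] span by simp
  have "coord e (\<Sum>e\<in>B. \<phi> (c e) * e) = c e" if "e \<in> B" for c e
  proof -
    let ?b = "\<Sum>e\<in>B. \<phi> (c e) * e"
    have "\<phi> (coord e ?b - c e) + \<phi> (c e) = \<phi> (coord e ?b)" for e
      by (simp flip: \<phi>(2))
    then have "\<phi> (coord e ?b - c e) = \<phi> (coord e ?b) - \<phi> (c e)" for e
      by (simp add: eq_diff_eq)
    then have "(\<Sum>e\<in>B. \<phi> (coord e ?b - c e) * e) = 0"
      by (simp add: left_diff_distrib sum_subtractf expand)
    from E.independentD[OF ind _ order_refl this that] show ?thesis
      by simp
  qed
  from that[OF card lin expand this] show ?thesis .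
qed

section \<open>Words of the extension code that vanish on a given set\<close>

text \<open>
  The words all of whose images under functionals lie in \<open>C\<close> form a subspace over the extension
  field, since \<open>b \<mapsto> f (c * b)\<close> is again a functional. This avoids expanding a multiple of a word
  in a basis of the extension field.
\<close>

lemma base_linear_ext_code:
  assumes C: "vec.subspace C" and "field_embedding \<phi>"
    and u: "u \<in> ext_code \<phi> C" and "base_linear \<phi> f"
  shows "(\<chi> i. f (u $ i)) \<in> C"
proof -
  let ?S = "{u. \<forall>f. base_linear \<phi> f \<longrightarrow> (\<chi> i. f (u $ i)) \<in> C}"
  have "vec.subspace ?S"
  proof (rule vec.subspaceI)
    show "0 \<in> ?S"
      using vec.subspace_0[OF C] by (auto simp: base_linear_zero zero_vec_def)
    show "u + v \<in> ?S" if "u \<in> ?S" "v \<in> ?S" for u v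
    proof safe
      fix f assume f: "base_linear \<phi> f"
      have "(\<chi> i. f ((u + v) $ i)) = (\<chi> i. f (u $ i)) + (\<chi> i. f (v $ i))"
        using f by (simp add: vec_eq_iff base_linear_def)
      then show "(\<chi> i. f ((u + v) $ i)) \<in> C"
        using that f vec.subspace_add[OF C] by simp
    qed
    show "c *s u \<in> ?S" if "u \<in> ?S" for c u
    proof safe
      fix f assume "base_linear \<phi> f"
      then have "base_linear \<phi> (\<lambda>b. f (c * b))"
        unfolding base_linear_def by (simp add: distrib_left mult.left_commute[of c])
      then show "(\<chi> i. f ((c *s u) $ i)) \<in> C"
        using that by (auto dest: spec[of _ "\<lambda>b. f (c * b)"])
    qed
  qed
  moreover have "(\<lambda>u. \<chi> i. \<phi> (u $ i)) ` C \<subseteq> ?S"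
  proof safe
    fix v f assume "v \<in> C" and f: "base_linear \<phi> f"
    have "f (\<phi> a) = f 1 * a" for a
      using f unfolding base_linear_def by (metis mult.commute mult.right_neutral)
    then have "(\<chi> i. f ((\<chi> i. \<phi> (v $ i)) $ i)) = f 1 *s v"
      by (simp add: vec_eq_iff)
    then show "(\<chi> i. f ((\<chi> i. \<phi> (v $ i)) $ i)) \<in> C"
      using \<open>v \<in> C\<close> vec.subspace_scale[OF C] by simp
  qed
  ultimately have "ext_code \<phi> C \<subseteq> ?S"
    unfolding ext_code_def by (intro vec.span_minimal)
  then show ?thesis
    using u assms(4) by blast
qed

lemma combination_in_ext_code:
  assumes "\<And>e. e \<in> B \<Longrightarrow> c e \<in> C"
  shows "(\<chi> i. \<Sum>e\<in>B. \<phi> (c e $ i) * e) \<in> ext_code \<phi> C"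
proof -
  have "(\<chi> i. \<Sum>e\<in>B. \<phi> (c e $ i) * e) = (\<Sum>e\<in>B. e *s (\<chi> i. \<phi> (c e $ i)))"
    by (simp add: vec_eq_iff mult.commute)
  also have "\<dots> \<in> ext_code \<phi> C"
    unfolding ext_code_def using assms
    by (intro vec.span_sum vec.span_scale vec.span_base) auto
  finally show ?thesis .
qed

text \<open>
  Taking coordinates in a basis of the extension field is a bijection between the words of the
  extension code that vanish on \<open>Z\<close> and the families, indexed by the basis, of codewords of \<open>C\<close>
  that vanish on \<open>Z\<close>.
\<close>

lemma card_ext_code_vanishing:
  fixes C :: "('a::{field,finite} ^ 'n::finite) set"
    and \<phi> :: "'a \<Rightarrow> 'b::{field,finite}"
  assumes C: "vec.subspace C" and \<phi>: "field_embedding \<phi>" and m: "CARD('b) = CARD('a) ^ m"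
  shows "card {u \<in> ext_code \<phi> C. \<forall>i\<in>Z. u $ i = 0} =
    (CARD('a) ^ m) ^ vec.dim {u \<in> C. \<forall>i\<in>Z. u $ i = 0}" (is "card ?D = _ ^ vec.dim ?C")
proof -
  obtain B :: "'b set" and coord :: "'b \<Rightarrow> 'b \<Rightarrow> 'a" where card: "card B = m"
    and lin: "\<And>e. base_linear \<phi> (coord e)"
    and expand: "\<And>b. (\<Sum>e\<in>B. \<phi> (coord e b) * e) = b"
    and coord: "\<And>c e. e \<in> B \<Longrightarrow> coord e (\<Sum>e\<in>B. \<phi> (c e) * e) = c e"
    by (rule field_embedding_coordinates[OF \<phi> m]) (rule that)
  have "bij_betw (\<lambda>u. \<lambda>e\<in>B. \<chi> i. coord e (u $ i)) ?D (B \<rightarrow>\<^sub>E ?C)"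
  proof (rule bij_betw_byWitness[where f' = "\<lambda>c. \<chi> i. \<Sum>e\<in>B. \<phi> (c e $ i) * e"])
    show "\<forall>u\<in>?D. (\<chi> i. \<Sum>e\<in>B. \<phi> ((\<lambda>e\<in>B. \<chi> i. coord e (u $ i)) e $ i) * e) = u"
      by (simp add: expand vec_eq_iff)
    show "\<forall>c\<in>B \<rightarrow>\<^sub>E ?C.
        (\<lambda>e\<in>B. \<chi> i. coord e ((\<chi> i. \<Sum>e\<in>B. \<phi> (c e $ i) * e) $ i)) = c"
    proof
      fix c assume c: "c \<in> B \<rightarrow>\<^sub>E ?C"
      have "(\<chi> i. coord e (\<Sum>e\<in>B. \<phi> (c e $ i) * e)) = c e" if "e \<in> B" for e
        using coord[OF that, of "\<lambda>e. c e $ _"] by (simp add: vec_eq_iff)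
      then show "(\<lambda>e\<in>B. \<chi> i. coord e ((\<chi> i. \<Sum>e\<in>B. \<phi> (c e $ i) * e) $ i)) = c"
        by (intro PiE_ext[OF _ c]) (use c in \<open>auto simp: PiE_iff\<close>)
    qed
    show "(\<lambda>u. \<lambda>e\<in>B. \<chi> i. coord e (u $ i)) ` ?D \<subseteq> B \<rightarrow>\<^sub>E ?C"
      using base_linear_ext_code[OF C \<phi> _ lin] base_linear_zero[OF lin] by auto
    show "(\<lambda>c. \<chi> i. \<Sum>e\<in>B. \<phi> (c e $ i) * e) ` (B \<rightarrow>\<^sub>E ?C) \<subseteq> ?D"
    proof safe
      fix c assume c: "c \<in> B \<rightarrow>\<^sub>E ?C"
      then show "(\<chi> i. \<Sum>e\<in>B. \<phi> (c e $ i) * e) \<in> ext_code \<phi> C"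
        by (intro combination_in_ext_code) (auto simp: PiE_iff)
      show "(\<chi> i. \<Sum>e\<in>B. \<phi> (c e $ i) * e) $ i = 0" if "i \<in> Z" for i
        using c that by (auto simp: PiE_iff field_embedding_zero[OF \<phi>] intro!: sum.neutral)
    qed
  qed
  then have "card ?D = card (B \<rightarrow>\<^sub>E ?C)"
    by (rule bij_betw_same_card)
  also have "\<dots> = card ?C ^ m"
    by (simp add: card_funcsetE card)
  also have "card ?C = CARD('a) ^ vec.dim ?C"
  proof (rule card_subspace)
    show "vec.subspace ?C"
      using C by (auto simp: vec.subspace_def)
  qed
  finally show ?thesis
    by (simp flip: power_mult add: mult.commute)
qed

section \<open>Expansion and rearrangement of the sums\<close>

text \<open>
  Expand \<open>w = (w - z) + z\<close> at the zero positions of \<open>u\<close>: a term of the product is given by the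
  set \<open>Y\<close> of those positions at which \<open>w - z\<close> is chosen.
\<close>

lemma power_wt_expansion:
  fixes u :: "'b::zero ^ 'n::finite" and w z :: "'c::comm_ring_1"
  shows "w ^ (card S - wt S u) * z ^ wt S u =
    (\<Sum>Y | Y \<subseteq> S \<and> (\<forall>i\<in>Y. u $ i = 0). (w - z) ^ card Y * z ^ (card S - card Y))"
proof -
  define N where "N = {i \<in> S. u $ i = 0}"
  have "card N + wt S u = card (N \<union> {i \<in> S. u $ i \<noteq> 0})"
    unfolding N_def wt_def by (rule card_Un_disjoint[symmetric]) auto
  also have "N \<union> {i \<in> S. u $ i \<noteq> 0} = S"
    unfolding N_def by blast
  finally have card: "card S = card N + wt S u"
    by simp
  have "w ^ card N = (\<Prod>i\<in>N. (w - z) + z)"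
    by simp
  also have "\<dots> = (\<Sum>Y\<in>Pow N. (w - z) ^ card Y * z ^ card (N - Y))"
    by (subst prod_add) simp_all
  finally have "w ^ card N * z ^ wt S u =
      (\<Sum>Y\<in>Pow N. (w - z) ^ card Y * (z ^ card (N - Y) * z ^ wt S u))"
    by (simp add: sum_distrib_right mult.assoc)
  also have "\<dots> = (\<Sum>Y\<in>Pow N. (w - z) ^ card Y * z ^ (card S - card Y))"
  proof (rule sum.cong[OF refl])
    fix Y assume "Y \<in> Pow N"
    then have "card (N - Y) + wt S u = card S - card Y"
      using card by (simp add: card_Diff_subset card_mono)
    then show "(w - z) ^ card Y * (z ^ card (N - Y) * z ^ wt S u) =
        (w - z) ^ card Y * z ^ (card S - card Y)"
      by (simp flip: power_add)
  qed
  also have "Pow N = {Y. Y \<subseteq> S \<and> (\<forall>i\<in>Y. u $ i = 0)}"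
    unfolding N_def by blast
  finally show ?thesis
    using card by simp
qed

lemma sum_by_two_statistics:
  fixes f :: "'d \<Rightarrow> 'c::comm_monoid_add" and g h :: "'d \<Rightarrow> nat"
  assumes "finite A" and "\<And>u. u \<in> A \<Longrightarrow> g u \<le> a" and "\<And>u. u \<in> A \<Longrightarrow> h u \<le> b"
  shows "(\<Sum>i = 0..a. \<Sum>j = 0..b. \<Sum>u | u \<in> A \<and> g u = i \<and> h u = j. f u) = (\<Sum>u\<in>A. f u)"
proof -
  have "(\<Sum>i = 0..a. \<Sum>j = 0..b. \<Sum>u | u \<in> A \<and> g u = i \<and> h u = j. f u) =
      (\<Sum>p\<in>{0..a} \<times> {0..b}. \<Sum>u | u \<in> A \<and> (g u, h u) = p. f u)"
    by (simp add: sum.cartesian_product case_prod_beta prod_eq_iff)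
  also have "\<dots> = (\<Sum>u\<in>A. f u)"
    using assms by (intro sum.group) auto
  finally show ?thesis .
qed

lemma jacobi_poly_sum_words:
  fixes C :: "('a::field ^ 'n::finite) set" and \<phi> :: "'a \<Rightarrow> 'b::{field,finite}"
  shows "jacobi_poly \<phi> C T = (\<Sum>u\<in>ext_code \<phi> C.
    (poly_x ^ (card (- T) - wt (- T) u) * poly_y ^ wt (- T) u) *
    (poly_w ^ (card T - wt T u) * poly_z ^ wt T u))"
    (is "_ = sum ?mon _")
proof -
  have wt_le: "wt S u \<le> card S" for S :: "'n set" and u :: "'b ^ 'n"
    unfolding wt_def by (rule card_mono) auto
  have "of_nat (A_coeff \<phi> C T i j) * poly_w ^ (card T - j) * poly_z ^ j
        * poly_x ^ (card (- T) - i) * poly_y ^ i =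
      (\<Sum>u | u \<in> ext_code \<phi> C \<and> wt (- T) u = i \<and> wt T u = j. ?mon u)" for i j
    by (simp add: A_coeff_def mult_ac)
  moreover have "CARD('n) - card T = card (- T)"
    by (simp add: Compl_eq_Diff_UNIV card_Diff_subset)
  ultimately show ?thesis
    using sum_by_two_statistics[where f = ?mon, of "ext_code \<phi> C" "wt (- T)" "card (- T)"
        "wt T" "card T"] wt_le
    by (simp add: jacobi_poly_def)
qed

lemma Q_coeff_sum_pairs:
  fixes C :: "('a::{field,finite} ^ 'n::finite) set" and g :: "nat \<Rightarrow> nat \<Rightarrow> 'c::comm_semiring_1"
  shows "(\<Sum>s = 0..card (- T). \<Sum>t = 0..card T. of_nat (Q_coeff C T m s t) * g s t) =
    (\<Sum>X\<in>Pow (- T). \<Sum>Y\<in>Pow T. of_nat (B_coeff C m X Y) * g (card X) (card Y))"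
proof -
  let ?f = "\<lambda>(X, Y). of_nat (B_coeff C m X Y) * g (card X) (card Y)"
  let ?P = "Pow (- T) \<times> Pow T"
  have Q: "of_nat (Q_coeff C T m s t) * g s t =
      (\<Sum>p | p \<in> ?P \<and> card (fst p) = s \<and> card (snd p) = t. ?f p)" for s t
  proof -
    have "of_nat (Q_coeff C T m s t) * g s t =
        (\<Sum>X | X \<subseteq> - T \<and> card X = s. \<Sum>Y | Y \<subseteq> T \<and> card Y = t. ?f (X, Y))"
      by (simp add: Q_coeff_def sum_distrib_right)
    also have "\<dots> = (\<Sum>p\<in>{X. X \<subseteq> - T \<and> card X = s} \<times> {Y. Y \<subseteq> T \<and> card Y = t}. ?f p)"
      by (subst sum.cartesian_product) (auto intro: sum.cong)
    also have "{X. X \<subseteq> - T \<and> card X = s} \<times> {Y. Y \<subseteq> T \<and> card Y = t} =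
        {p. p \<in> ?P \<and> card (fst p) = s \<and> card (snd p) = t}"
      by auto
    finally show ?thesis .
  qed
  have "(\<Sum>s = 0..card (- T). \<Sum>t = 0..card T. of_nat (Q_coeff C T m s t) * g s t) =
      (\<Sum>p\<in>?P. ?f p)"
    unfolding Q by (rule sum_by_two_statistics) (auto intro!: card_mono)
  then show ?thesis
    by (simp add: sum.cartesian_product)
qed

section \<open>The extended Jacobi polynomial\<close>

theorem theorem3p4:
  fixes C :: "('a::{field,finite} ^ 'n::finite) set"
    and T :: "'n set"
    and m :: nat
    and \<phi> :: "'a \<Rightarrow> 'b::{field,finite}"
  assumes "vec.subspace C"
    and "m \<ge> 1"
    and "CARD('b) = CARD('a) ^ m"
    and "field_embedding \<phi>"
  shows "jacobi_poly \<phi> C T =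
    (\<Sum>s = 0..CARD('n) - card T. \<Sum>t = 0..card T.
       of_nat (Q_coeff C T m s t) * (poly_w - poly_z) ^ t * poly_z ^ (card T - t)
         * (poly_x - poly_y) ^ s * poly_y ^ (CARD('n) - card T - s))"
proof -
  let ?D = "ext_code \<phi> C"
  let ?n = "card (- T)"
  let ?g = "\<lambda>s t. ((poly_x - poly_y) ^ s * poly_y ^ (?n - s))
    * ((poly_w - poly_z) ^ t * poly_z ^ (card T - t))"
  let ?zero = "\<lambda>u X. \<forall>i\<in>X. u $ i = 0"
  have n: "CARD('n) - card T = ?n"
    by (simp add: Compl_eq_Diff_UNIV card_Diff_subset)
  have B: "B_coeff C m X Y = card {u \<in> ?D. ?zero u X \<and> ?zero u Y}" for X Y
    using card_ext_code_vanishing[OF assms(1,4,3), of "X \<union> Y"]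
    by (simp add: B_coeff_def ell_def shortened_code_def ball_Un)
  have "jacobi_poly \<phi> C T =
      (\<Sum>u\<in>?D. \<Sum>X | X \<in> Pow (- T) \<and> ?zero u X. \<Sum>Y | Y \<in> Pow T \<and> ?zero u Y.
        ?g (card X) (card Y))"
    unfolding jacobi_poly_sum_words power_wt_expansion
    by (simp add: sum_product)
  also have "\<dots> = (\<Sum>X\<in>Pow (- T). \<Sum>u | u \<in> ?D \<and> ?zero u X. \<Sum>Y | Y \<in> Pow T \<and> ?zero u Y.
        ?g (card X) (card Y))"
    by (rule sum.swap_restrict) simp_all
  also have "\<dots> = (\<Sum>X\<in>Pow (- T). \<Sum>Y\<in>Pow T. \<Sum>u | u \<in> {u \<in> ?D. ?zero u X} \<and> ?zero u Y.
        ?g (card X) (card Y))"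
    by (intro sum.cong[OF refl] sum.swap_restrict) simp_all
  also have "\<dots> = (\<Sum>X\<in>Pow (- T). \<Sum>Y\<in>Pow T. of_nat (B_coeff C m X Y) * ?g (card X) (card Y))"
    by (simp add: B conj_assoc)
  also have "\<dots> = (\<Sum>s = 0..?n. \<Sum>t = 0..card T. of_nat (Q_coeff C T m s t) * ?g s t)"
    by (rule Q_coeff_sum_pairs[symmetric])
  finally show ?thesis
    by (simp add: n mult_ac)
qed

end
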